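(* For any $k\leq q\in\mathbb{N}$ there exists an affine $k$-crystal $C\in\mathcal{T}^{\frac{k^2+k}{2}\cdot\mathbf{1}_q}(\mathbb{Z})$ whose $k$-shadow is hollow.
   Context: For $n,q\in\mathbb{N}$, $\mathcal{T}^{n\cdot\mathbf{1}_q}(\mathbb{Z})$ is the set of functions $C:[n]^q\to\mathbb{Z}$ (cubical tensors of dimension $q$ and width $n$), where $[n]=\{1,\dots,n\}$. For a tuple $\mathbf{b}=(b_1,\dots,b_q)$ and $\mathbf{i}=(i_1,\dots,i_p)\in[q]^p$, $\mathbf{b}_{\mathbf{i}}=(b_{i_1},\dots,b_{i_p})$. The projection of $C$ onto $\mathbf{i}\in[q]^p$ is the tensor $\Pi_{\mathbf{i}}*C:[n]^p\to\mathbb{Z}$, $(\Pi_{\mathbf{i}}*C)(\mathbf{a})=\sum_{\mathbf{b}\in[n]^q,\ \mathbf{b}_{\mathbf{i}}=\mathbf{a}}C(\mathbf{b})$. Let $[q]^k_\to$ be the set of strictly increasing tuples in $[q]^k$. For $k\in\{0,\dots,q\}$, $C$ is a $k$-crystal if $\Pi_{\mathbf{i}}*C=\Pi_{\mathbf{j}}*C$ for all $\mathbf{i},\mathbf{j}\in[q]^k_\to$; this common tensor in $\mathcal{T}^{n\cdot\mathbf{1}_k}(\mathbb{Z})$ is the $k$-shadow of $C$. A tensor is affine if its entries sum to $1$. A tensor $T:[n]^k\to\mathbb{Z}$ is hollow if $T(\mathbf{a})=0$ for every $\mathbf{a}\in[n]^k$ whose entries are not pairwise distinct. *)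

theory Defs
  imports Main "HOL-Library.FuncSet" "HOL-Library.NList"
begin

text \<open>
  Tuples are lists, and \<open>[n]\<^sup>q\<close> is \<^term>\<open>nlists q {1..n}\<close>. Tuple entries and tuple positions
  are numbered from 1, so the position \<open>j\<close> of \<open>b\<close> is \<open>b ! (j - 1)\<close>.
\<close>

abbreviation tuples :: "nat \<Rightarrow> nat \<Rightarrow> nat list set" where
  "tuples n q \<equiv> nlists q {1..n}"

text \<open>
  Tensors are functions on \<open>[n]\<^sup>q\<close>, taken extensional (i.e. \<^const>\<open>undefined\<close> outside
  \<open>[n]\<^sup>q\<close>), so that equality of tensors is equality in HOL.
\<close>

definition tensors :: "nat \<Rightarrow> nat \<Rightarrow> (nat list \<Rightarrow> int) set" where
  "tensors n q = tuples n q \<rightarrow>\<^sub>E UNIV"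

definition subtuple :: "'a list \<Rightarrow> nat list \<Rightarrow> 'a list" where
  "subtuple b i = map (\<lambda>j. b ! (j - 1)) i"

text \<open>The tensor \<open>\<Pi>\<^sub>i * C\<close>, for \<open>C\<close> of width \<open>n\<close> and dimension \<open>q\<close>, and \<open>i \<in> [q]\<^sup>p\<close> with \<open>p = length i\<close>.\<close>

definition projection :: "nat \<Rightarrow> nat \<Rightarrow> nat list \<Rightarrow> (nat list \<Rightarrow> int) \<Rightarrow> nat list \<Rightarrow> int" where
  "projection n q i C =
     (\<lambda>a\<in>tuples n (length i). \<Sum>b\<in>{b \<in> tuples n q. subtuple b i = a}. C b)"

definition increasing_tuples :: "nat \<Rightarrow> nat \<Rightarrow> nat list set" where
  "increasing_tuples q k = {i \<in> tuples q k. sorted_wrt (<) i}"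

definition is_crystal :: "nat \<Rightarrow> nat \<Rightarrow> nat \<Rightarrow> (nat list \<Rightarrow> int) \<Rightarrow> bool" where
  "is_crystal n q k C \<longleftrightarrow> k \<le> q \<and> C \<in> tensors n q \<and>
     (\<forall>i\<in>increasing_tuples q k. \<forall>j\<in>increasing_tuples q k.
        projection n q i C = projection n q j C)"

text \<open>
  Well defined for every crystal: \<^term>\<open>increasing_tuples q k\<close> is nonempty when \<open>k \<le> q\<close>.
\<close>

definition shadow :: "nat \<Rightarrow> nat \<Rightarrow> nat \<Rightarrow> (nat list \<Rightarrow> int) \<Rightarrow> nat list \<Rightarrow> int" where
  "shadow n q k C = (THE S. \<forall>i\<in>increasing_tuples q k. projection n q i C = S)"

definition affine_tensor :: "nat \<Rightarrow> nat \<Rightarrow> (nat list \<Rightarrow> int) \<Rightarrow> bool" where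
  "affine_tensor n q C \<longleftrightarrow> (\<Sum>b\<in>tuples n q. C b) = 1"

definition hollow :: "nat \<Rightarrow> nat \<Rightarrow> (nat list \<Rightarrow> int) \<Rightarrow> bool" where
  "hollow n k T \<longleftrightarrow> (\<forall>a\<in>tuples n k. \<not> distinct a \<longrightarrow> T a = 0)"

lemma upt_in_increasing_tuples:
  assumes "k \<le> q"
  shows "[1..<Suc k] \<in> increasing_tuples q k"
proof -
  have "set [1..<Suc k] = {1..<Suc k}" by (rule set_upt)
  also have "{1..<Suc k} \<subseteq> {1..q}" using assms by (intro subsetI) simp
  finally have "[1..<Suc k] \<in> tuples q k"
    by (intro nlistsI) (simp_all only: length_upt diff_Suc_1 One_nat_def diff_Suc_Suc diff_zero)
  then show ?thesis
    unfolding increasing_tuples_def using sorted_wrt_upt by blast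
qed

lemma shadow_eq_projection:
  assumes "is_crystal n q k C" and "i \<in> increasing_tuples q k"
  shows "shadow n q k C = projection n q i C"
  unfolding shadow_def
proof (rule the_equality)
  show "\<forall>j\<in>increasing_tuples q k. projection n q j C = projection n q i C"
    using assms unfolding is_crystal_def by blast
next
  fix S assume "\<forall>j\<in>increasing_tuples q k. projection n q j C = S"
  then have "projection n q i C = S" using assms(2) by (rule bspec)
  then show "S = projection n q i C" by (rule sym)
qed

lemma shadow_in_tensors:
  assumes "is_crystal n q k C"
  shows "shadow n q k C \<in> tensors n k"
proof -
  have "k \<le> q" using assms by (simp add: is_crystal_def)
  then have i: "[1..<Suc k] \<in> increasing_tuples q k" by (rule upt_in_increasing_tuples)
  then have "length [1..<Suc k] = k"
    unfolding increasing_tuples_def by (blast intro: nlistsE_length)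
  then show ?thesis
    unfolding shadow_eq_projection[OF assms i] projection_def tensors_def
    by (simp only: restrict_PiE_iff) blast
qed

end

theory Submission
  imports Defs
begin

text \<open>
  A signed weight \<open>S\<close> on words of length at most \<open>m\<close>, such that summing out any letter of a word
  gives the weight of the shortened word, extends to words of length \<open>m + 1\<close>: fix a letter \<open>x\<^sub>j\<close> for
  each position and take \<open>S = \<Sum>\<^sub>U (-1)\<^bsup>m - |U|\<^esup> S\<^sub>U \<otimes> x\<close>, the sum ranging over the proper subsets \<open>U\<close>
  of the positions, where \<open>S\<^sub>U\<close> lives on the positions in \<open>U\<close> and \<open>x\<close> fills the others. On summing
  out position \<open>i\<close>, the terms for \<open>U\<close> and \<open>U \<union> {i}\<close> cancel, and only the complement of \<open>i\<close> survives.
  If the \<open>x\<^sub>j\<close> are distinct new letters, words with a repeated letter keep weight 0. So \<open>1 + 2 + \<dots> + k\<close>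
  letters suffice up to length \<open>k\<close>; from there to length \<open>q\<close>, hollowness is no longer required and
  any letter will do as \<open>x\<^sub>j\<close>.
\<close>

definition coherent :: "nat \<Rightarrow> nat \<Rightarrow> (nat list \<Rightarrow> int) \<Rightarrow> bool" where
  "coherent n m S \<longleftrightarrow>
     (\<forall>u v. length u + length v < m \<longrightarrow> (\<Sum>c\<in>{1..n}. S (u @ c # v)) = S (u @ v))"

lemma coherentD:
  "coherent n m S \<Longrightarrow> length u + length v < m \<Longrightarrow> (\<Sum>c\<in>{1..n}. S (u @ c # v)) = S (u @ v)"
  unfolding coherent_def by blast

text \<open>
  The sum over all sets \<open>U\<close> of positions of \<open>b\<close> such that \<open>b\<close> agrees with \<open>xs\<close> outside \<open>U\<close>, with
  sign \<open>(-1)\<^bsup>length b - |U|\<^esup>\<close>, of the weight of \<open>w\<close> followed by the restriction of \<open>b\<close> to \<open>U\<close>.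
\<close>

fun alternating_sum :: "(nat list \<Rightarrow> int) \<Rightarrow> nat list \<Rightarrow> nat list \<Rightarrow> nat list \<Rightarrow> int" where
  "alternating_sum S (b # bs) (x # xs) w =
     alternating_sum S bs xs (w @ [b]) - (if b = x then alternating_sum S bs xs w else 0)"
| "alternating_sum S _ _ w = S w"

text \<open>Discards the term where \<open>U\<close> consists of all positions.\<close>

definition truncate :: "nat \<Rightarrow> (nat list \<Rightarrow> int) \<Rightarrow> nat list \<Rightarrow> int" where
  "truncate m S w = (if length w \<le> m then S w else 0)"

text \<open>On words of length \<open>m + 1\<close> the sign of \<open>alternating_sum\<close> is
  opposite to the wanted (-1)^(m - |U|), hence the minus. Longer words get values too, which
  coherence up to \<open>m + 1\<close> ignores.\<close>

definition extend :: "nat \<Rightarrow> nat list \<Rightarrow> (nat list \<Rightarrow> int) \<Rightarrow> nat list \<Rightarrow> int" where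
  "extend m xs S w = (if length w \<le> m then S w else - alternating_sum (truncate m S) w xs [])"

lemma extend_le: "length w \<le> m \<Longrightarrow> extend m xs S w = S w"
  and extend_gt: "m < length w \<Longrightarrow> extend m xs S w = - alternating_sum (truncate m S) w xs []"
  by (simp_all add: extend_def)

text \<open>
  Truncation is why the case \<open>m\<close> differs: there the term keeping all of \<open>v\<close> and the summed letter
  is missing from the left-hand side.
\<close>

lemma sum_alternating_sum_prefix:
  assumes "coherent n m S"
  shows "length v = length xs \<Longrightarrow> length w + length w' + length v \<le> m \<Longrightarrow>
    (\<Sum>c\<in>{1..n}. alternating_sum (truncate m S) v xs (w @ c # w')) =
      alternating_sum (truncate m S) v xs (w @ w') -
      (if length w + length w' + length v = m then S (w @ w' @ v) else 0)"
proof (induction v xs arbitrary: w' rule: list_induct2')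
  case 1
  show ?case
  proof (cases "length w + length w' = m")
    case False
    with 1 coherentD[OF assms, of w w'] show ?thesis by (simp add: truncate_def)
  qed (simp add: truncate_def)
next
  case (4 b v x xs)
  have "(\<Sum>c\<in>{1..n}. alternating_sum (truncate m S) (b # v) (x # xs) (w @ c # w')) =
    (\<Sum>c\<in>{1..n}. alternating_sum (truncate m S) v xs (w @ c # w' @ [b])) -
    (if b = x then (\<Sum>c\<in>{1..n}. alternating_sum (truncate m S) v xs (w @ c # w')) else 0)"
    by (simp add: sum_subtractf)
  then show ?case using 4 by (simp add: "4.IH"[of "w' @ [b]"] "4.IH"[of w'])
qed simp_all

lemma sum_alternating_sum_insert:
  assumes "coherent n m S"
  shows "length xs = Suc (length u + length v) \<Longrightarrow> set xs \<subseteq> {1..n} \<Longrightarrow>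
    length w + length u + length v \<le> m \<Longrightarrow>
    (\<Sum>c\<in>{1..n}. alternating_sum (truncate m S) (u @ c # v) xs w) =
      - (if length w + length u + length v = m then S (w @ u @ v) else 0)"
proof (induction u arbitrary: xs w)
  case Nil
  then obtain x ys where xs: "xs = x # ys" "x \<in> {1..n}" by (cases xs) auto
  \<comment> \<open>Exactly one \<open>c\<close> equals \<open>x\<close>, so the fill term is
    subtracted once. The prefix lemma cancels it and leaves only the defect at full length.\<close>
  have "(\<Sum>c\<in>{1..n}. alternating_sum (truncate m S) ([] @ c # v) xs w) =
     (\<Sum>c\<in>{1..n}. alternating_sum (truncate m S) v ys (w @ c # [])) - alternating_sum (truncate m S) v ys w"
    using xs by (simp add: sum_subtractf)
  then show ?case
    using sum_alternating_sum_prefix[OF assms, of v ys w "[]"] Nil xs by simp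
next
  case (Cons b u)
  then obtain x ys where xs: "xs = x # ys" by (cases xs) auto
  have "(\<Sum>c\<in>{1..n}. alternating_sum (truncate m S) ((b # u) @ c # v) xs w) =
    (\<Sum>c\<in>{1..n}. alternating_sum (truncate m S) (u @ c # v) ys (w @ [b])) -
    (if b = x then (\<Sum>c\<in>{1..n}. alternating_sum (truncate m S) (u @ c # v) ys w) else 0)"
    by (simp add: xs sum_subtractf)
  \<comment> \<open>Filling with \<open>x\<close> drops \<open>b\<close>, so the words in the second
    sum are too short for the defect and that sum vanishes.\<close>
  then show ?case
    using Cons.IH[of ys "w @ [b]"] Cons.IH[of ys w] Cons.prems xs by simp
qed

lemma coherent_extend:
  assumes "coherent n m S" and "length xs = Suc m" and "set xs \<subseteq> {1..n}"
  shows "coherent n (Suc m) (extend m xs S)"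
  unfolding coherent_def
proof (intro allI impI)
  fix u v :: "nat list"
  assume "length u + length v < Suc m"
  then show "(\<Sum>c\<in>{1..n}. extend m xs S (u @ c # v)) = extend m xs S (u @ v)"
    using coherentD[OF assms(1), of u v] sum_alternating_sum_insert[OF assms(1), of xs u v "[]"] assms(2,3)
    by (cases "length u + length v = m") (simp_all add: extend_le extend_gt sum_negf)
qed

lemma alternating_sum_nonzero:
  assumes "\<And>v. S v \<noteq> 0 \<Longrightarrow> set v \<subseteq> A"
  shows "alternating_sum S b xs w \<noteq> 0 \<Longrightarrow> length b = length xs \<Longrightarrow>
    set w \<subseteq> A \<and> set b \<subseteq> A \<union> set xs"
proof (induction b xs arbitrary: w rule: list_induct2')
  case (4 b bs x xs)
  show ?case
  proof (cases "alternating_sum S bs xs (w @ [b]) = 0")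
    case False
    with "4.IH"[of "w @ [b]"] 4(3) show ?thesis by auto
  next
    case True
    with 4(2) have "b = x" "alternating_sum S bs xs w \<noteq> 0" by (auto split: if_splits)
    with "4.IH"[of w] 4(3) show ?thesis by auto
  qed
qed (simp_all add: assms)

text \<open>A nonzero term keeps distinct letters from \<open>A\<close> and fills the other
  positions with distinct letters outside \<open>A\<close>, so no letter can repeat.\<close>

lemma distinct_alternating_sum_nonzero:
  assumes "\<And>v. S v \<noteq> 0 \<Longrightarrow> set v \<subseteq> A \<and> distinct v"
  shows "alternating_sum S b xs w \<noteq> 0 \<Longrightarrow> length b = length xs \<Longrightarrow>
     distinct xs \<Longrightarrow> set xs \<inter> A = {} \<Longrightarrow> distinct (w @ b)"
proof (induction b xs arbitrary: w rule: list_induct2')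
  case (4 b bs x xs)
  show ?case
  proof (cases "alternating_sum S bs xs (w @ [b]) = 0")
    case False
    with "4.IH"[of "w @ [b]"] 4(3-5) show ?thesis by simp
  next
    case True
    with 4(2) have *: "b = x" "alternating_sum S bs xs w \<noteq> 0" by (auto split: if_splits)
    then have "set w \<subseteq> A" "set bs \<subseteq> A \<union> set xs"
      using alternating_sum_nonzero[of S A bs xs w] 4(3) assms by auto
    moreover have "distinct (w @ bs)" using "4.IH"[of w] 4(3-5) * by simp
    ultimately show ?thesis using 4(4,5) * by auto
  qed
qed (simp_all add: assms)

lemma ex_coherent_distinct:
  assumes "(m\<^sup>2 + m) div 2 \<le> n"
  shows "\<exists>S. coherent n m S \<and> S [] = 1 \<and>
    (\<forall>v. length v \<le> m \<and> S v \<noteq> 0 \<longrightarrow> set v \<subseteq> {1..(m\<^sup>2 + m) div 2} \<and> distinct v)"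
  using assms
proof (induction m)
  case 0
  show ?case by (rule exI[of _ "\<lambda>_. 1"]) (auto simp: coherent_def)
next
  case (Suc m)
  define N where "N = (m\<^sup>2 + m) div 2"
  have N: "((Suc m)\<^sup>2 + Suc m) div 2 = N + Suc m"
    unfolding N_def by (simp add: power2_eq_square)
  with Suc obtain S where S: "coherent n m S" "S [] = 1"
    "\<And>v. length v \<le> m \<Longrightarrow> S v \<noteq> 0 \<Longrightarrow> set v \<subseteq> {1..N} \<and> distinct v"
    unfolding N_def by auto
  \<comment> \<open>One fresh letter for each of the \<open>m + 1\<close> positions; the ambient
    alphabet \<open>{1..n}\<close> stays fixed.\<close>
  define xs where "xs = [Suc N..<Suc (N + Suc m)]"
  have xs: "length xs = Suc m" "set xs \<subseteq> {1..n}" "distinct xs" "set xs \<inter> {1..N} = {}"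
    "{1..N} \<union> set xs \<subseteq> {1..N + Suc m}"
    using N Suc.prems by (auto simp: xs_def simp del: upt_Suc)
  \<comment> \<open>Truncation cuts off the words longer than \<open>m\<close>, where
    \<open>S\<close> is uncontrolled, so the support bound holds for all words.\<close>
  have T: "set v \<subseteq> {1..N} \<and> distinct v" if "truncate m S v \<noteq> 0" for v
    using that S(3)[of v] by (auto simp: truncate_def split: if_splits)
  have "set v \<subseteq> {1..N + Suc m} \<and> distinct v" if v: "length v \<le> Suc m" "extend m xs S v \<noteq> 0" for v
  proof (cases "length v \<le> m")
    case True
    then show ?thesis using v S(3)[of v] by (force simp: extend_le)
  next
    case False
    then have "alternating_sum (truncate m S) v xs [] \<noteq> 0" "length v = length xs"
      using v xs by (auto simp: extend_gt)
    then show ?thesis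
      using alternating_sum_nonzero[of "truncate m S" "{1..N}" v xs "[]"] T xs
        distinct_alternating_sum_nonzero[of "truncate m S" "{1..N}" v xs "[]"] by auto
  qed
  then show ?case unfolding N
    using coherent_extend[OF S(1) xs(1,2)] S(2)
    by (intro exI[of _ "extend m xs S"]) (auto simp: extend_le)
qed

lemma ex_coherent_extension:
  assumes "coherent n k S" and "1 \<le> n" and "k \<le> q"
  shows "\<exists>S'. coherent n q S' \<and> (\<forall>v. length v \<le> k \<longrightarrow> S' v = S v)"
  using assms(3)
proof (induction q rule: dec_induct)
  case base
  show ?case using assms(1) by blast
next
  case (step q)
  then obtain S' where "coherent n q S'" "\<forall>v. length v \<le> k \<longrightarrow> S' v = S v" by blast
  then show ?case
    \<comment> \<open>The letter 1 fills every position; it exists because the alphabet is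
      nonempty.\<close>
    using coherent_extend[of n q S' "replicate (Suc q) 1"] assms(2) step(1)
    by (intro exI[of _ "extend q (replicate (Suc q) 1) S'"] conjI)
      (simp_all add: extend_le del: replicate_Suc)
qed

lemma sum_nlists_Suc:
  assumes "finite A"
  shows "(\<Sum>b\<in>nlists (Suc q) A. f b) = (\<Sum>c\<in>A. \<Sum>b\<in>nlists q A. f (c # b))"
proof -
  have "nlists (Suc q) A = (\<lambda>(c, b). c # b) ` (A \<times> nlists q A)"
    by (auto simp: nlists_Suc)
  then have "(\<Sum>b\<in>nlists (Suc q) A. f b) = (\<Sum>p\<in>A \<times> nlists q A. f (case p of (c, b) \<Rightarrow> c # b))"
    by (simp add: sum.reindex inj_on_def case_prod_unfold)
  then show ?thesis by (simp add: sum.cartesian_product case_prod_unfold)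
qed

text \<open>Read \<open>b\<close> from the left, with \<open>s\<close> the number of its first
  position and \<open>p\<close> the letters already read. A letter at a position in \<open>i\<close>
  is forced by \<open>a\<close>; any other is summed out by coherence.\<close>

lemma coherent_sum_nlists:
  assumes "coherent n m S"
  shows "sorted_wrt (<) i \<Longrightarrow> set i \<subseteq> {s..<s + q} \<Longrightarrow> a \<in> nlists (length i) {1..n} \<Longrightarrow>
    length p + q \<le> m \<Longrightarrow>
    (\<Sum>b\<in>nlists q {1..n}. if map (\<lambda>j. b ! (j - s)) i = a then S (p @ b) else 0) = S (p @ a)"
proof (induction q arbitrary: s i a p)
  case 0
  then show ?case by simp
next
  case (Suc q)
  show ?case
  proof (cases "s \<in> set i")
    case True
    with Suc.prems(1,2) obtain i' where i: "i = s # i'" by (cases i) force+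
    with Suc.prems(3) obtain c0 a' where a: "a = c0 # a'" "c0 \<in> {1..n}" "a' \<in> nlists (length i') {1..n}"
      by (auto simp: nlists_Suc)
    have i': "set i' \<subseteq> {Suc s..<Suc s + q}" "sorted_wrt (<) i'"
      using Suc.prems(1,2) i by (auto simp: Suc_le_eq)
    have shift: "map (\<lambda>j. (c # b) ! (j - s)) i = c # map (\<lambda>j. b ! (j - Suc s)) i'" for c b
      using i' by (auto simp: i nth_Cons' intro!: map_cong)
    have "(\<Sum>b\<in>nlists (Suc q) {1..n}. if map (\<lambda>j. b ! (j - s)) i = a then S (p @ b) else 0) =
      (\<Sum>c\<in>{1..n}. if c = c0 then \<Sum>b\<in>nlists q {1..n}.
         if map (\<lambda>j. b ! (j - Suc s)) i' = a' then S ((p @ [c0]) @ b) else 0 else 0)"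
      unfolding sum_nlists_Suc[OF finite_atLeastAtMost] shift a(1)
      by (intro sum.cong refl) (auto cong: if_cong)
    also have "\<dots> = S ((p @ [c0]) @ a')"
      using Suc.IH[OF i'(2,1) a(3), of "p @ [c0]"] Suc.prems(4) a(2) by simp
    finally show ?thesis by (simp add: a)
  next
    case False
    then have i: "set i \<subseteq> {Suc s..<Suc s + q}" using Suc.prems(2) by (force simp: Suc_le_eq le_less)
    have shift: "map (\<lambda>j. (c # b) ! (j - s)) i = map (\<lambda>j. b ! (j - Suc s)) i" for c b
      using i by (auto simp: nth_Cons')
    have len: "length a = length i" using Suc.prems(3) by simp
    \<comment> \<open>Skipping position \<open>s\<close> leaves \<open>i\<close> only
      \<open>q\<close> positions, so \<open>p @ c # a\<close> has length at most \<open>m\<close>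
      and coherence applies.\<close>
    have "length i \<le> q"
      using card_mono[OF _ i] distinct_card[of i] Suc.prems(1) strict_sorted_iff[of i]
      by simp
    have "(\<Sum>b\<in>nlists (Suc q) {1..n}. if map (\<lambda>j. b ! (j - s)) i = a then S (p @ b) else 0) =
      (\<Sum>c\<in>{1..n}. \<Sum>b\<in>nlists q {1..n}.
         if map (\<lambda>j. b ! (j - Suc s)) i = a then S ((p @ [c]) @ b) else 0)"
      unfolding sum_nlists_Suc[OF finite_atLeastAtMost] shift by (simp cong: if_cong)
    also have "\<dots> = (\<Sum>c\<in>{1..n}. S (p @ c # a))"
      using Suc.IH[OF Suc.prems(1) i Suc.prems(3)] Suc.prems(4) by simp
    also have "\<dots> = S (p @ a)"
      using coherentD[OF assms] Suc.prems(4) len \<open>length i \<le> q\<close> by simp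
    finally show ?thesis .
  qed
qed

theorem theorem2p4:
  fixes k q :: nat
  assumes "1 \<le> k" and "k \<le> q"
  shows "\<exists>C \<in> tensors ((k^2 + k) div 2) q.
           affine_tensor ((k^2 + k) div 2) q C \<and>
           is_crystal ((k^2 + k) div 2) q k C \<and>
           hollow ((k^2 + k) div 2) k (shadow ((k^2 + k) div 2) q k C)"
proof -
  define n where "n = (k^2 + k) div 2"
  have "1 \<le> n" using assms(1) unfolding n_def by (cases k) (auto simp: power2_eq_square)
  obtain R where R: "coherent n k R" "R [] = 1" "\<And>v. length v \<le> k \<Longrightarrow> R v \<noteq> 0 \<Longrightarrow> distinct v"
    using ex_coherent_distinct[of k n] unfolding n_def by auto
  obtain S where S: "coherent n q S" "\<And>v. length v \<le> k \<Longrightarrow> S v = R v"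
    using ex_coherent_extension[OF R(1) \<open>1 \<le> n\<close> assms(2)] by blast
  define C where "C = restrict S (tuples n q)"
  have fin: "finite (tuples n q)"
    unfolding nlists_def conj_commute[of "length _ = _"] by (rule finite_lists_length_eq) simp
  have tensor: "C \<in> tensors n q" by (simp add: C_def tensors_def)
  \<comment> \<open>The right-hand side does not depend on \<open>i\<close>: this gives the crystal
    property and identifies the shadow with \<open>S\<close> on words of length
    \<open>k\<close>.\<close>
  have proj: "projection n q i C = restrict S (tuples n k)" if "i \<in> increasing_tuples q k" for i
  proof -
    have i: "sorted_wrt (<) i" "set i \<subseteq> {1..<1 + q}" "length i = k"
      using that unfolding increasing_tuples_def nlists_def by force+
    have "(\<Sum>b\<in>{b \<in> tuples n q. subtuple b i = a}. C b) = S a" if "a \<in> tuples n k" for a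
    proof -
      have "(\<Sum>b\<in>{b \<in> tuples n q. subtuple b i = a}. C b) =
        (\<Sum>b\<in>tuples n q. if map (\<lambda>j. b ! (j - 1)) i = a then S ([] @ b) else 0)"
        by (rule sum.mono_neutral_cong_left[OF fin]) (auto simp: C_def subtuple_def)
      also have "\<dots> = S ([] @ a)"
        using coherent_sum_nlists[OF S(1) i(1,2), of a "[]"] that i(3) by simp
      finally show ?thesis by simp
    qed
    then show ?thesis unfolding projection_def i(3) by (intro restrict_ext) simp
  qed
  have crystal: "is_crystal n q k C"
    unfolding is_crystal_def using assms(2) tensor proj by simp
  \<comment> \<open>The sum of all entries is the projection onto the empty tuple, hence the weight
    of the empty word.\<close>
  have "affine_tensor n q C"
    unfolding affine_tensor_def
    using coherent_sum_nlists[OF S(1), of "[]" 0 q "[]" "[]"] S(2)[of "[]"] R(2) by (simp add: C_def)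
  moreover have "hollow n k (shadow n q k C)"
    unfolding hollow_def
      shadow_eq_projection[OF crystal upt_in_increasing_tuples[OF assms(2)]]
      proj[OF upt_in_increasing_tuples[OF assms(2)]]
    using S(2) R(3) by force
  ultimately show ?thesis using tensor crystal unfolding n_def by blast
qed

end
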